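(* Let $X(t)$, $t\ge0$, be a continuous-time Markov chain on $\{0,1,\dots,S\}$ with nonnegative locally integrable transition intensities $q_{ij}(t)$ and with absorption in zero, i.e. $q_{0j}(t)\equiv0$ for all $j\ge1$. Let $d_1,\dots,d_S$ be positive numbers, $D=\mathrm{diag}(d_1,\dots,d_S)$, and put $$\alpha_k(t)=-a_{kk}(t)-\sum_{1\le i\le S,\ i\ne k}\frac{d_i}{d_k}a_{ik}(t)\ (1\le k\le S),\quad \beta^*(t)=\min_{1\le k\le S}\alpha_k(t),\quad \beta_*(t)=\max_{1\le k\le S}\alpha_k(t),$$ where $a_{ij}(t)=q_{ji}(t)$ for $i\ne j$ and $a_{ii}(t)=-\sum_{j\ne i}q_{ij}(t)$. Suppose that the positive numbers $d_i$ are such that $$\int_0^\infty\beta^*(t)\,dt=+\infty .$$ Then $X(t)$ is weakly ergodic, and for any initial probability distributions $\mathbf p^*(0),\mathbf p^{**}(0)$ and all $t\ge0$, $$\|\mathbf z^{*}(t)-\mathbf z^{**}(t)\|_{1D}\le e^{-\int_0^t\beta^*(\tau)\,d\tau}\,\|\mathbf z^{*}(0)-\mathbf z^{**}(0)\|_{1D}.$$ Moreover, if the initial conditions are such that $\mathbf z^*(0)-\mathbf z^{**}(0)\ge\mathbf 0$ (coordinatewise), then for all $t\ge0$, $$\|\mathbf z^{*}(t)-\mathbf z^{**}(t)\|_{1D}\ge e^{-\int_0^t\beta_*(\tau)\,d\tau}\,\|\mathbf z^{*}(0)-\mathbf z^{**}(0)\|_{1D}.$$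
   Context: Setting. $q_{ij}(t)$ is the intensity of transition from state $i$ to state $j\ne i$, and $A(t)=(a_{ij}(t))_{i,j=0}^S$ is the transposed intensity matrix. The vector of state probabilities $\mathbf p(t)=(p_0(t),\dots,p_S(t))^T$, $p_i(t)=\Pr\{X(t)=i\}$, is the solution of the forward Kolmogorov system $\frac{d\mathbf p}{dt}=A(t)\mathbf p(t)$ (a locally absolutely continuous function satisfying the equation for almost all $t$); if $\mathbf p(0)$ is a probability vector then so is $\mathbf p(t)$ for every $t\ge0$. Reduced vector. $\mathbf z(t)=(p_1(t),\dots,p_S(t))^T$; because of absorption in zero it satisfies $\frac{d\mathbf z}{dt}=B(t)\mathbf z$ with $B(t)=(a_{ij}(t))_{i,j=1}^S$. Given two initial probability vectors $\mathbf p^*(0),\mathbf p^{**}(0)$, the corresponding solutions are $\mathbf p^*(t),\mathbf p^{**}(t)$, with reduced vectors $\mathbf z^*(t),\mathbf z^{**}(t)$. With $H(t)=(h_{ij}(t))=DB(t)D^{-1}$, the quantity $\alpha_k(t)$ equals $-\sum_{i=1}^S h_{ik}(t)$. Notation. $\|\mathbf x\|=\sum_i|x_i|$ is the $l_1$-norm and $\|\mathbf z\|_{1D}=\|D\mathbf z\|$. The chain is weakly ergodic if $\|\mathbf p^*(t)-\mathbf p^{**}(t)\|\to0$ as $t\to\infty$ for any initial probability distributions $\mathbf p^*(0),\mathbf p^{**}(0)$. $\int_0^\infty\beta^*(t)\,dt$ means $\lim_{T\to\infty}\int_0^T\beta^*(t)\,dt$. *)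

theory Defs
  imports "HOL-Analysis.Analysis"
begin

(* Epsilon-delta absolute continuity: P is a finite family of non-overlapping
   closed subintervals of {a..b}, each encoded by its pair of end points. *)
definition abs_continuous_on_interval :: "real \<Rightarrow> real \<Rightarrow> (real \<Rightarrow> real) \<Rightarrow> bool" where
  "abs_continuous_on_interval a b f \<longleftrightarrow>
     (\<forall>\<epsilon>>0. \<exists>\<delta>>0. \<forall>P :: (real \<times> real) set.
        finite P \<and> (\<forall>(u, v)\<in>P. a \<le> u \<and> u \<le> v \<and> v \<le> b) \<and>
        pairwise (\<lambda>(u, v) (u', v'). {u<..<v} \<inter> {u'<..<v'} = {}) P \<and>
        (\<Sum>(u, v)\<in>P. v - u) < \<delta>
        \<longrightarrow> (\<Sum>(u, v)\<in>P. \<bar>f v - f u\<bar>) < \<epsilon>)"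

definition locally_abs_continuous :: "(real \<Rightarrow> real) \<Rightarrow> bool" where
  "locally_abs_continuous f \<longleftrightarrow> (\<forall>T\<ge>0. abs_continuous_on_interval 0 T f)"

definition locally_integrable :: "(real \<Rightarrow> real) \<Rightarrow> bool" where
  "locally_integrable f \<longleftrightarrow> (\<forall>T\<ge>0. f absolutely_integrable_on {0..T})"

(* The states are 0, ..., S; q i j t is the intensity of the transition from i to j
   at time t. The values q i i t are never used. *)
definition transposed_intensity ::
  "nat \<Rightarrow> (nat \<Rightarrow> nat \<Rightarrow> real \<Rightarrow> real) \<Rightarrow> real \<Rightarrow> nat \<Rightarrow> nat \<Rightarrow> real" where
  "transposed_intensity S q t i j =
     (if i = j then - (\<Sum>k\<in>{0..S} - {i}. q i k t) else q j i t)"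

definition prob_vector :: "nat \<Rightarrow> (nat \<Rightarrow> real) \<Rightarrow> bool" where
  "prob_vector S x \<longleftrightarrow> (\<forall>i\<in>{0..S}. 0 \<le> x i) \<and> (\<Sum>i\<in>{0..S}. x i) = 1"

definition kolmogorov_solution ::
  "nat \<Rightarrow> (nat \<Rightarrow> nat \<Rightarrow> real \<Rightarrow> real) \<Rightarrow> (real \<Rightarrow> nat \<Rightarrow> real) \<Rightarrow> bool" where
  "kolmogorov_solution S q p \<longleftrightarrow>
     (\<forall>i\<in>{0..S}. locally_abs_continuous (\<lambda>t. p t i)) \<and>
     (AE t in lebesgue. 0 \<le> t \<longrightarrow>
        (\<forall>i\<in>{0..S}. ((\<lambda>s. p s i) has_real_derivative
            (\<Sum>j\<in>{0..S}. transposed_intensity S q t i j * p t j)) (at t)))"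

(* The chain enters through its family of state probability vectors
   p t i = Pr(X t = i), one for each initial distribution. *)
definition state_probabilities ::
  "nat \<Rightarrow> (nat \<Rightarrow> nat \<Rightarrow> real \<Rightarrow> real) \<Rightarrow> (real \<Rightarrow> nat \<Rightarrow> real) \<Rightarrow> bool" where
  "state_probabilities S q p \<longleftrightarrow> kolmogorov_solution S q p \<and> prob_vector S (p 0)"

definition l1_norm :: "nat set \<Rightarrow> (nat \<Rightarrow> real) \<Rightarrow> real" where
  "l1_norm I x = (\<Sum>i\<in>I. \<bar>x i\<bar>)"

definition weakly_ergodic :: "nat \<Rightarrow> (nat \<Rightarrow> nat \<Rightarrow> real \<Rightarrow> real) \<Rightarrow> bool" where
  "weakly_ergodic S q \<longleftrightarrow>
     (\<forall>p p'. state_probabilities S q p \<and> state_probabilities S q p' \<longrightarrow>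
        ((\<lambda>t. l1_norm {0..S} (\<lambda>i. p t i - p' t i)) \<longlongrightarrow> 0) at_top)"

(* The reduced vector z = (x 1, ..., x S) is x with its 0-th coordinate ignored,
   so this norm only looks at the indices 1, ..., S. *)
definition norm_1D :: "nat \<Rightarrow> (nat \<Rightarrow> real) \<Rightarrow> (nat \<Rightarrow> real) \<Rightarrow> real" where
  "norm_1D S d x = l1_norm {1..S} (\<lambda>i. d i * x i)"

definition alpha ::
  "nat \<Rightarrow> (nat \<Rightarrow> nat \<Rightarrow> real \<Rightarrow> real) \<Rightarrow> (nat \<Rightarrow> real) \<Rightarrow> nat \<Rightarrow> real \<Rightarrow> real" where
  "alpha S q d k t =
     - transposed_intensity S q t k k
     - (\<Sum>i\<in>{1..S} - {k}. d i / d k * transposed_intensity S q t i k)"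

definition beta_min ::
  "nat \<Rightarrow> (nat \<Rightarrow> nat \<Rightarrow> real \<Rightarrow> real) \<Rightarrow> (nat \<Rightarrow> real) \<Rightarrow> real \<Rightarrow> real" where
  "beta_min S q d t = Min ((\<lambda>k. alpha S q d k t) ` {1..S})"

definition beta_max ::
  "nat \<Rightarrow> (nat \<Rightarrow> nat \<Rightarrow> real \<Rightarrow> real) \<Rightarrow> (nat \<Rightarrow> real) \<Rightarrow> real \<Rightarrow> real" where
  "beta_max S q d t = Max ((\<lambda>k. alpha S q d k t) ` {1..S})"

end

theory Submission
  imports Defs
begin

text \<open>
  The difference w of two solutions satisfies w' = B w almost everywhere, and almost everywhere
  the derivative of |w_i| is sgn (w_i) w_i'. As the off-diagonal entries of B are nonnegative, the
  weighted norm V = sum of d_i |w_i| satisfies V' <= - beta^* V, and the sum of |w_i| - w_i is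
  nonincreasing, so that w stays nonnegative if it starts so; in that case V' >= - beta_* V.
  Both bounds follow by integrating (ln V)'. Since the total mass of w is zero, decay
  of V forces decay of the full l1-norm.
\<close>

section \<open>Absolutely continuous functions\<close>

text \<open>Since the intensities are only locally integrable, the system holds off a null set, and
  a continuous function may still grow on a null set, as the Cantor function does. Every integration
  of a derivative therefore rests on a fundamental theorem of calculus for absolutely continuous
  functions with a null exceptional set. Absolute values bring a second kind of bad point: |w_i| has
  a corner where w_i vanishes with nonzero derivative. Such zeros are isolated, hence countable, and
  join the exceptional set; at the other zeros sgn 0 = 0 gives the right derivative. The equation w'
  = B w closes on the states 1..S because absorption makes the entries a_i0 with i >= 1 vanish. The
  columns of A sum to zero, and deleting row 0 removes the nonnegative entry a_0j, so the columns of
  B have nonpositive sums; this is what makes the sum of |w_i| - w_i decrease. The quotient V' / V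
  makes sense only where V > 0, and V may reach zero, so both integrations of (ln V)' need a
  separate argument at a zero of V.\<close>

definition nonoverlapping_intervals :: "real \<Rightarrow> real \<Rightarrow> (real \<times> real) set \<Rightarrow> bool" where
  "nonoverlapping_intervals a b P \<longleftrightarrow>
     finite P \<and> (\<forall>(u, v)\<in>P. a \<le> u \<and> u \<le> v \<and> v \<le> b) \<and>
     pairwise (\<lambda>(u, v) (u', v'). {u<..<v} \<inter> {u'<..<v'} = {}) P"

lemma abs_continuous_on_interval_alt:
  "abs_continuous_on_interval a b f \<longleftrightarrow>
     (\<forall>\<epsilon>>0. \<exists>\<delta>>0. \<forall>P. nonoverlapping_intervals a b P \<and> (\<Sum>(u, v)\<in>P. v - u) < \<delta>
        \<longrightarrow> (\<Sum>(u, v)\<in>P. \<bar>f v - f u\<bar>) < \<epsilon>)"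
  by (simp add: abs_continuous_on_interval_def nonoverlapping_intervals_def)

text \<open>A null set lies in an open \<open>U\<close> of measure below the \<open>\<delta>\<close>
  of absolute continuity. A gauge with value \<open>U\<close> on \<open>E\<close> forces every
  interval tagged in \<open>E\<close> into \<open>U\<close>, so these intervals have total length
  below \<open>\<delta>\<close>.\<close>

lemma abs_continuous_null_tags:
  assumes ac: "abs_continuous_on_interval a b f" and neg: "negligible E" and "0 < e"
  obtains \<gamma> where "gauge \<gamma>"
    "\<And>p. p tagged_division_of {a..b} \<Longrightarrow> \<gamma> fine p \<Longrightarrow>
       (\<Sum>(x, K)\<in>{(x, K)\<in>p. x \<in> E}. \<bar>f (Sup K) - f (Inf K)\<bar>) < e"
proof -
  obtain \<delta> where "\<delta> > 0" and \<delta>: "\<And>P. nonoverlapping_intervals a b P \<Longrightarrow> (\<Sum>(u, v)\<in>P. v - u) < \<delta> \<Longrightarrow> (\<Sum>(u, v)\<in>P. \<bar>f v - f u\<bar>) < e"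
    using ac[unfolded abs_continuous_on_interval_alt, rule_format, OF \<open>0 < e\<close>] by auto
  have E0: "E \<in> null_sets lebesgue"
    using neg by (simp add: negligible_iff_null_sets)
  then obtain U where U: "open U" "E \<subseteq> U" "U - E \<in> lmeasurable" "emeasure lebesgue (U - E) < ennreal \<delta>"
    using sets_lebesgue_outer_open[of E \<delta>] \<open>\<delta> > 0\<close> by blast
  have Um: "U \<in> lmeasurable"
    using fmeasurable.Un[OF fmeasurableI_null_sets[OF E0] U(3)] U(2) by (simp add: Un_absorb1)
  have "measure lebesgue (U - E) = measure lebesgue U"
    using E0 Um by (simp add: measure_Diff_null_set fmeasurableD)
  then have Ud: "measure lebesgue U < \<delta>"
    using U \<open>\<delta> > 0\<close> by (simp add: emeasure_eq_measure2 ennreal_less_iff)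
  define \<gamma> where "\<gamma> x = (if x \<in> E then U else UNIV)" for x
  show thesis
  proof
    show "gauge \<gamma>"
      using U by (auto simp: gauge_def \<gamma>_def)
  next
    fix p assume p: "p tagged_division_of {a..b}" and fine: "\<gamma> fine p"
    define q where "q = {(x, K)\<in>p. x \<in> E}"
    define h :: "real \<times> real set \<Rightarrow> real \<times> real" where "h = (\<lambda>(x, K). (Inf K, Sup K))"
    have fin: "finite q"
      using p unfolding q_def by (auto intro: finite_subset[of _ p])
    have int: "\<exists>u v. K = {u..v} \<and> u \<le> v \<and> a \<le> u \<and> v \<le> b \<and> K \<subseteq> U"
      if "(x, K) \<in> q" for x K
    proof -
      have xK: "(x, K) \<in> p" "x \<in> E" using that by (auto simp: q_def)
      then obtain u v where uv: "K = cbox u v" and "x \<in> K" "K \<subseteq> {a..b}"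
        using p by blast
      then have "u \<le> v" by auto
      moreover have "K \<subseteq> U"
        using fine xK unfolding fine_def \<gamma>_def by fastforce
      ultimately show ?thesis
        using uv \<open>K \<subseteq> {a..b}\<close> by (rule_tac exI[of _ u], rule_tac exI[of _ v]) auto
    qed
    have disj: "{Inf K<..<Sup K} \<inter> {Inf K'<..<Sup K'} = {}"
      if "(x, K) \<in> q" "(x', K') \<in> q" "(x, K) \<noteq> (x', K')" for x K x' K'
    proof -
      have "interior K \<inter> interior K' = {}"
        using p that unfolding q_def by (intro tagged_division_ofD(5)) auto
      moreover have "interior K = {Inf K<..<Sup K}" "interior K' = {Inf K'<..<Sup K'}"
        using int[OF that(1)] int[OF that(2)] by auto
      ultimately show ?thesis by simp
    qed
    \<comment> \<open>Absolute continuity speaks of sets of end point pairs, so the tags are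
      forgotten through \<open>h\<close>. A collision under \<open>h\<close> forces a degenerate
      interval, and there the summand \<open>g\<close> vanishes; injectivity of \<open>h\<close>
      need not be shown.\<close>
    have reindex: "(\<Sum>y\<in>h ` q. g y) = (\<Sum>y\<in>q. g (h y))"
      if "\<And>u. g (u, u) = 0" for g :: "real \<times> real \<Rightarrow> real"
    proof -
      have "(\<Sum>y\<in>h ` q. g y) = sum (g \<circ> h) q"
      proof (rule sum.reindex_nontrivial[OF fin])
        fix y y' assume *: "y \<in> q" "y' \<in> q" "y \<noteq> y'" "h y = h y'"
        obtain x K x' K' where y: "y = (x, K)" "y' = (x', K')" by (cases y, cases y')
        with *(4) have eq: "Inf K = Inf K'" "Sup K = Sup K'" by (simp_all add: h_def)
        have "{Inf K<..<Sup K} \<inter> {Inf K'<..<Sup K'} = {}"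
          using disj *(1-3) unfolding y by blast
        then have "{Inf K<..<Sup K} = {}" unfolding eq by simp
        then have "Sup K \<le> Inf K" by (simp only: greaterThanLessThan_empty_iff)
        moreover have "Inf K \<le> Sup K" using int *(1) y by fastforce
        ultimately show "g (h y) = 0" using that by (simp add: h_def y)
      qed
      then show ?thesis by simp
    qed
    have "(\<Sum>(u, v)\<in>h ` q. \<bar>f v - f u\<bar>) < e"
    proof (rule \<delta>)
      show "nonoverlapping_intervals a b (h ` q)"
        unfolding nonoverlapping_intervals_def
      proof (intro conjI)
        show "finite (h ` q)" using fin by simp
        show "\<forall>(u, v)\<in>h ` q. a \<le> u \<and> u \<le> v \<and> v \<le> b"
          using int by (fastforce simp: h_def)
        show "pairwise (\<lambda>(u, v) (u', v'). {u<..<v} \<inter> {u'<..<v'} = {}) (h ` q)"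
          using disj by (fastforce simp: pairwise_def h_def)
      qed
      \<comment> \<open>The pieces overlap at most in end points, so their lengths add up to the
        measure of their union, which lies inside \<open>U\<close>.\<close>
      have "(\<Sum>(u, v)\<in>h ` q. v - u) = (\<Sum>(x, K)\<in>q. Sup K - Inf K)"
        by (subst reindex) (auto simp: h_def split_def)
      also have "\<dots> = (\<Sum>y\<in>q. measure lebesgue (snd y))"
      proof (rule sum.cong, safe)
        fix x K assume "(x, K) \<in> q"
        from int[OF this] show "Sup K - Inf K = measure lebesgue (snd (x, K))" by auto
      qed
      also have "\<dots> = measure lebesgue (\<Union>(snd ` q))"
      proof (rule measure_negligible_finite_Union_image[symmetric, OF fin])
        show "snd y \<in> lmeasurable" if "y \<in> q" for y
          using int[of "fst y" "snd y"] that by auto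
        show "pairwise (\<lambda>x y. negligible (snd x \<inter> snd y)) q"
        proof (rule pairwiseI)
          fix y y' assume yq: "y \<in> q" "y' \<in> q" "y \<noteq> y'"
          obtain x K x' K' where y: "y = (x, K)" "y' = (x', K')" by (cases y, cases y')
          with yq have *: "(x, K) \<in> q" "(x', K') \<in> q" "(x, K) \<noteq> (x', K')" by simp_all
          have "K \<inter> K' \<subseteq> {Inf K, Sup K, Inf K', Sup K'}"
          proof
            fix y assume y: "y \<in> K \<inter> K'"
            have "Inf K \<le> y" "y \<le> Sup K" "Inf K' \<le> y" "y \<le> Sup K'"
              using y int[OF *(1)] int[OF *(2)] by auto
            moreover have "y \<notin> {Inf K<..<Sup K} \<inter> {Inf K'<..<Sup K'}"
              using disj[OF *(1,2)] *(3) by auto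
            ultimately show "y \<in> {Inf K, Sup K, Inf K', Sup K'}" by auto
          qed
          moreover have "negligible {Inf K, Sup K, Inf K', Sup K'}"
            by (intro negligible_finite) simp
          ultimately show "negligible (snd y \<inter> snd y')"
            unfolding y snd_conv by (rule negligible_subset[rotated])
        qed
      qed
      also have "\<dots> \<le> measure lebesgue U"
      proof (rule measure_mono_fmeasurable[OF _ _ Um])
        show "\<Union>(snd ` q) \<subseteq> U" using int by fastforce
        show "\<Union>(snd ` q) \<in> sets lebesgue"
        proof (rule sets.finite_UN[OF fin])
          show "snd y \<in> sets lebesgue" if "y \<in> q" for y
            using int[of "fst y" "snd y"] that by auto
        qed
      qed
      finally show "(\<Sum>(u, v)\<in>h ` q. v - u) < \<delta>" using Ud by simp
    qed
    moreover have "(\<Sum>(u, v)\<in>h ` q. \<bar>f v - f u\<bar>) = (\<Sum>(x, K)\<in>q. \<bar>f (Sup K) - f (Inf K)\<bar>)"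
      by (subst reindex) (auto simp: h_def split_def)
    ultimately show "(\<Sum>(x, K)\<in>{(x, K)\<in>p. x \<in> E}. \<bar>f (Sup K) - f (Inf K)\<bar>) < e"
      by (simp add: q_def)
  qed
qed

text \<open>The tags in the exceptional null set are controlled by absolute continuity, all others by
  the straddle lemma, so no Lebesgue differentiation theorem is needed.\<close>

theorem abs_continuous_has_integral_derivative:
  assumes "a \<le> b" and ac: "abs_continuous_on_interval a b f" and neg: "negligible E"
    and deriv: "\<And>x. x \<in> {a..b} - E \<Longrightarrow> (f has_real_derivative f' x) (at x)"
  shows "(f' has_integral (f b - f a)) {a..b}"
proof (cases "a = b")
  case True
  then show ?thesis using has_integral_refl(2)[of f' a] by simp
next
  case False
  with \<open>a \<le> b\<close> have "a < b" by simp
  \<comment> \<open>With the value 0 on \<open>E\<close>, a piece tagged in \<open>E\<close>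
    contributes only the increment of \<open>f\<close> to the error.\<close>
  define g where "g x = (if x \<in> E then 0 else f' x)" for x
  have "(g has_integral (f b - f a)) {a..b}"
    unfolding has_integral_factor_content_real
  proof (intro allI impI)
    fix e :: real assume "e > 0"
    have "\<exists>d>0. x \<in> {a..b} - E \<longrightarrow>
       (\<forall>y. norm (y-x) < d \<longrightarrow> norm (f y - f x - (y-x) * g x) \<le> e / 2 * norm (y-x))" for x
    proof (cases "x \<in> {a..b} - E")
      case True
      with deriv have "(f has_derivative (*) (g x)) (at x)"
        by (auto simp: g_def has_field_derivative_def)
      moreover have "(*) (g x) = (\<lambda>h. h * g x)" by auto
      ultimately have "(f has_derivative (\<lambda>h. h * g x)) (at x)" by simp
      then show ?thesis
        using \<open>e > 0\<close> unfolding has_derivative_within_alt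
        by (drule_tac conjunct2) (drule_tac spec[of _ "e / 2"], auto)
    next
      case False
      then show ?thesis by (intro exI[of _ 1]) auto
    qed
    then have "\<exists>d. \<forall>x. d x > 0 \<and> (x \<in> {a..b} - E \<longrightarrow>
       (\<forall>y. norm (y-x) < d x \<longrightarrow> norm (f y - f x - (y-x) * g x) \<le> e / 2 * norm (y-x)))"
      by (intro choice) blast
    then obtain d where d: "\<And>x. 0 < d x"
      "\<And>x y. \<lbrakk>x \<in> {a..b} - E; norm (y-x) < d x\<rbrakk>
           \<Longrightarrow> norm (f y - f x - (y-x) * g x) \<le> e / 2 * norm (y-x)"
      by blast
    \<comment> \<open>The admissible error e * (b - a) is halved: one part for the tags in
      \<open>E\<close>, the other for the remaining tags.\<close>
    have pos: "0 < e / 2 * (b - a)"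
      using \<open>a < b\<close> \<open>e > 0\<close> by simp
    obtain \<gamma> where "gauge \<gamma>" and \<gamma>: "\<And>p. p tagged_division_of {a..b} \<Longrightarrow> \<gamma> fine p \<Longrightarrow>
       (\<Sum>(x, K)\<in>{(x, K)\<in>p. x \<in> E}. \<bar>f (Sup K) - f (Inf K)\<bar>) < e / 2 * (b - a)"
      using abs_continuous_null_tags[OF ac neg pos] by blast
    show "\<exists>\<gamma>. gauge \<gamma> \<and> (\<forall>p. p tagged_division_of {a..b} \<and> \<gamma> fine p \<longrightarrow>
      norm ((\<Sum>(x, K)\<in>p. measure lborel K *\<^sub>R g x) - (f b - f a)) \<le> e * measure lborel {a..b})"
    proof (intro exI conjI allI impI)
      show "gauge (\<lambda>x. \<gamma> x \<inter> ball x (d x))"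
        using \<open>gauge \<gamma>\<close> d(1) by (intro gauge_Int gauge_ball_dependent) auto
    next
      fix p assume p: "p tagged_division_of {a..b} \<and> (\<lambda>x. \<gamma> x \<inter> ball x (d x)) fine p"
      then have ptag: "p tagged_division_of {a..b}" and fine: "\<gamma> fine p" "(\<lambda>x. ball x (d x)) fine p"
        by (auto simp: fine_Int)
      have fin: "finite p" using ptag by auto
      define D where "D = (\<lambda>(x, K). measure lborel K * g x - (f (Sup K) - f (Inf K)))"
      define B where "B = (\<lambda>(x :: real, K :: real set). e / 2 * (Sup K - Inf K))"
      have ba: "b - a = (\<Sum>(x, K)\<in>p. Sup K - Inf K)" "f b - f a = (\<Sum>(x, K)\<in>p. f (Sup K) - f (Inf K))"
        using additive_tagged_division_1[where f= "\<lambda>x. x"] additive_tagged_division_1[where f= f]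
          \<open>a \<le> b\<close> ptag by auto
      have KI: "\<exists>u v. K = {u..v} \<and> u \<le> x \<and> x \<le> v \<and> a \<le> u \<and> v \<le> b" if xK: "(x, K) \<in> p" for x K
      proof -
        obtain u v where uv: "K = cbox u v" and "x \<in> K" "K \<subseteq> {a..b}"
          using tagged_division_ofD(2-4)[OF ptag xK] by auto
        then show ?thesis by (rule_tac exI[of _ u], rule_tac exI[of _ v]) auto
      qed
      have Bnn: "0 \<le> B y" if "y \<in> p" for y
        using KI[of "fst y" "snd y"] that \<open>e > 0\<close> by (auto simp: B_def split_def)
      have out: "\<bar>D y\<bar> \<le> B y" if "y \<in> p" "fst y \<notin> E" for y
      proof -
        obtain x K where y: "y = (x, K)" by force
        with that have xK: "(x, K) \<in> p" "x \<notin> E" by auto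
        then obtain u v where uv: "K = {u..v}" "u \<le> x" "x \<le> v" "a \<le> u" "v \<le> b"
          using KI by blast
        have "K \<subseteq> ball x (d x)" using fine(2) xK by auto
        moreover have "u \<in> K" "v \<in> K" using uv by auto
        ultimately have "u \<in> ball x (d x)" "v \<in> ball x (d x)" by blast+
        then have lt: "norm (u - x) < d x" "norm (v - x) < d x"
          by (simp_all add: dist_real_def abs_minus_commute)
        have x: "x \<in> {a..b} - E" using uv xK by auto
        have "\<bar>f u - f x - (u-x) * g x\<bar> \<le> e / 2 * (x - u)" "\<bar>f v - f x - (v-x) * g x\<bar> \<le> e / 2 * (v - x)"
          using d(2)[OF x lt(1)] d(2)[OF x lt(2)] uv by auto
        \<comment> \<open>Splitting at the tag, which lies between u and v, gives two errors whose
          bounds add up to e / 2 times the length of the piece.\<close>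
        moreover have "D y = (f u - f x - (u-x) * g x) - (f v - f x - (v-x) * g x)"
          using uv y by (simp add: D_def algebra_simps)
        moreover have "B y = e / 2 * (x - u) + e / 2 * (v - x)"
          using uv y by (simp add: B_def flip: distrib_left)
        ultimately show ?thesis by linarith
      qed
      have "(\<Sum>(x, K)\<in>p. measure lborel K *\<^sub>R g x) - (f b - f a) = (\<Sum>y\<in>p. D y)"
        by (simp add: ba D_def split_def sum_subtractf)
      also have "\<bar>\<dots>\<bar> \<le> (\<Sum>y\<in>p. \<bar>D y\<bar>)" by (rule sum_abs)
      also have "\<dots> = (\<Sum>y\<in>{y\<in>p. fst y \<notin> E}. \<bar>D y\<bar>) + (\<Sum>y\<in>{y\<in>p. fst y \<in> E}. \<bar>D y\<bar>)"
      proof -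
        have "p = {y\<in>p. fst y \<notin> E} \<union> {y\<in>p. fst y \<in> E}" by blast
        moreover have "{y\<in>p. fst y \<notin> E} \<inter> {y\<in>p. fst y \<in> E} = {}" by blast
        ultimately show ?thesis
          using fin sum.union_disjoint[of "{y\<in>p. fst y \<notin> E}" "{y\<in>p. fst y \<in> E}" "\<lambda>y. \<bar>D y\<bar>"] by simp
      qed
      also have "(\<Sum>y\<in>{y\<in>p. fst y \<in> E}. \<bar>D y\<bar>) =
          (\<Sum>(x, K)\<in>{(x, K)\<in>p. x \<in> E}. \<bar>f (Sup K) - f (Inf K)\<bar>)"
        by (intro sum.cong) (auto simp: D_def g_def)
      also have "(\<Sum>y\<in>{y\<in>p. fst y \<notin> E}. \<bar>D y\<bar>) \<le> (\<Sum>y\<in>{y\<in>p. fst y \<notin> E}. B y)"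
        using out by (intro sum_mono) auto
      also have "\<dots> \<le> (\<Sum>y\<in>p. B y)"
        using fin Bnn by (intro sum_mono2) auto
      also have "\<dots> = e / 2 * (b - a)"
        by (simp add: ba B_def split_def sum_distrib_left)
      finally show "norm ((\<Sum>(x, K)\<in>p. measure lborel K *\<^sub>R g x) - (f b - f a)) \<le> e * measure lborel {a..b}"
        using \<gamma>[OF ptag fine(1)] \<open>a < b\<close> by (simp add: field_simps)
    qed
  qed
  then show ?thesis
    by (rule has_integral_spike[OF neg, rotated]) (auto simp: g_def)
qed

text \<open>Near such a zero the difference quotient is nonzero, so no other zero of
  \<open>f\<close> is nearby. The set thus consists of isolated points, and by the Lindelof property
  countably many isolating open sets cover it.\<close>

lemma countable_transversal_zeros:
  fixes f :: "real \<Rightarrow> real"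
  shows "countable {x. f x = 0 \<and> (\<exists>D. (f has_real_derivative D) (at x) \<and> D \<noteq> 0)}" (is "countable ?Z")
proof -
  have isol: "\<exists>U. open U \<and> x \<in> U \<and> U \<inter> ?Z \<subseteq> {x}" if "x \<in> ?Z" for x
  proof -
    from that obtain D where D: "(f has_real_derivative D) (at x)" "D \<noteq> 0" "f x = 0" by auto
    then have "((\<lambda>y. (f y - f x) / (y - x)) \<longlongrightarrow> D) (at x)"
      by (simp add: has_field_derivative_iff)
    then have "\<forall>\<^sub>F y in at x. (f y - f x) / (y - x) \<noteq> 0"
      using D(2) by (rule tendsto_imp_eventually_ne)
    then obtain U where "open U" "x \<in> U" "\<And>y. y \<in> U \<Longrightarrow> y \<noteq> x \<Longrightarrow> (f y - f x) / (y - x) \<noteq> 0"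
      unfolding eventually_at_topological by blast
    then show ?thesis using D(3) by (intro exI[of _ U]) auto
  qed
  define F where "F = {U. open U \<and> (\<exists>x. U \<inter> ?Z \<subseteq> {x})}"
  have "open U" if "U \<in> F" for U
    using that by (simp add: F_def)
  then obtain F' where F': "F' \<subseteq> F" "countable F'" "\<Union>F' = \<Union>F"
    by (rule Lindelof)
  have "?Z \<subseteq> \<Union>F"
    using isol unfolding F_def by blast
  then have "?Z = (\<Union>U\<in>F'. U \<inter> ?Z)"
    using F'(3) by blast
  moreover have "countable (U \<inter> ?Z)" if "U \<in> F'" for U
  proof -
    from that F'(1) obtain x where "U \<inter> ?Z \<subseteq> {x}" unfolding F_def by blast
    then show ?thesis by (rule countable_subset) simp
  qed
  then have "countable (\<Union>U\<in>F'. U \<inter> ?Z)"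
    using F'(2) by (intro countable_UN)
  ultimately show ?thesis by (rule ssubst)
qed

section \<open>Stability of absolute continuity, and the derivative of an absolute value\<close>

lemma abs_continuous_on_interval_subset:
  assumes "abs_continuous_on_interval a b f" "a \<le> a'" "b' \<le> b"
  shows "abs_continuous_on_interval a' b' f"
  unfolding abs_continuous_on_interval_alt
proof (intro allI impI)
  fix \<epsilon> :: real assume "\<epsilon> > 0"
  with assms(1) obtain \<delta> where "\<delta> > 0" and \<delta>: "\<forall>P. nonoverlapping_intervals a b P \<and>
        (\<Sum>(u, v)\<in>P. v - u) < \<delta>
        \<longrightarrow> (\<Sum>(u, v)\<in>P. \<bar>f v - f u\<bar>) < \<epsilon>"
    unfolding abs_continuous_on_interval_alt by blast
  have "nonoverlapping_intervals a b P" if "nonoverlapping_intervals a' b' P" for P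
    using that assms(2,3) unfolding nonoverlapping_intervals_def by fastforce
  with \<open>\<delta> > 0\<close> \<delta> show "\<exists>\<delta>>0. \<forall>P. nonoverlapping_intervals a' b' P \<and>
        (\<Sum>(u, v)\<in>P. v - u) < \<delta>
        \<longrightarrow> (\<Sum>(u, v)\<in>P. \<bar>f v - f u\<bar>) < \<epsilon>"
    by blast
qed

lemma abs_continuous_imp_continuous_on:
  assumes "abs_continuous_on_interval a b f"
  shows "continuous_on {a..b} f"
  unfolding continuous_on_iff
proof (intro ballI allI impI)
  fix x \<epsilon> :: real assume x: "x \<in> {a..b}" and "\<epsilon> > 0"
  with assms obtain \<delta> where "\<delta> > 0" and \<delta>: "\<forall>P. nonoverlapping_intervals a b P \<and>
        (\<Sum>(u, v)\<in>P. v - u) < \<delta>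
        \<longrightarrow> (\<Sum>(u, v)\<in>P. \<bar>f v - f u\<bar>) < \<epsilon>"
    unfolding abs_continuous_on_interval_alt by blast
  have "dist (f y) (f x) < \<epsilon>" if y: "y \<in> {a..b}" "dist y x < \<delta>" for y
  proof -
    have "\<bar>f (max x y) - f (min x y)\<bar> < \<epsilon>"
      using spec[OF \<delta>, of "{(min x y, max x y)}"] x y
      by (auto simp: dist_real_def nonoverlapping_intervals_def)
    then show ?thesis by (auto simp: dist_real_def max_def min_def split: if_splits)
  qed
  with \<open>\<delta> > 0\<close> show "\<exists>\<delta>>0. \<forall>y\<in>{a..b}. dist y x < \<delta> \<longrightarrow> dist (f y) (f x) < \<epsilon>"
    by blast
qed

text \<open>All closure properties needed below (differences, sums, weighted absolute values,
  logarithms away from zero) are instances of this increment bound for a suitable \<open>I\<close>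
  and \<open>C\<close>.\<close>

lemma abs_continuous_Lipschitz_combination:
  assumes "finite I" and ac: "\<And>i. i \<in> I \<Longrightarrow> abs_continuous_on_interval a b (f i)"
    and "C \<ge> 0"
    and lip: "\<And>u v. a \<le> u \<Longrightarrow> u \<le> v \<Longrightarrow> v \<le> b \<Longrightarrow> \<bar>F v - F u\<bar> \<le> C * (\<Sum>i\<in>I. \<bar>f i v - f i u\<bar>)"
  shows "abs_continuous_on_interval a b F"
  unfolding abs_continuous_on_interval_alt
proof (intro allI impI)
  fix \<epsilon> :: real assume "\<epsilon> > 0"
  \<comment> \<open>The added 1 keeps the denominator positive when C or the cardinality is 0, and
    makes the final bound strict.\<close>
  define \<eta> where "\<eta> = \<epsilon> / (C * card I + 1)"
  have "C * card I + 1 > 0" using \<open>C \<ge> 0\<close> by (simp add: add_nonneg_pos)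
  then have "\<eta> > 0" and \<eta>: "C * (card I * \<eta>) < \<epsilon>"
    using \<open>\<epsilon> > 0\<close> by (simp_all add: \<eta>_def field_simps)
  have "\<exists>\<delta>>0. \<forall>P. nonoverlapping_intervals a b P \<and>
        (\<Sum>(u, v)\<in>P. v - u) < \<delta>
        \<longrightarrow> (\<Sum>(u, v)\<in>P. \<bar>f i v - f i u\<bar>) < \<eta>" if "i \<in> I" for i
    using ac[OF that] \<open>\<eta> > 0\<close> unfolding abs_continuous_on_interval_alt by blast
  then obtain \<delta> where \<delta>0: "\<And>i. i \<in> I \<Longrightarrow> \<delta> i > 0" and \<delta>: "\<And>i. i \<in> I \<Longrightarrow> \<forall>P. nonoverlapping_intervals a b P \<and>
        (\<Sum>(u, v)\<in>P. v - u) < \<delta> i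
        \<longrightarrow> (\<Sum>(u, v)\<in>P. \<bar>f i v - f i u\<bar>) < \<eta>"
    by metis
  \<comment> \<open>The inserted 1 keeps the minimum meaningful for empty \<open>I\<close>.\<close>
  define \<delta>' where "\<delta>' = Min (insert 1 (\<delta> ` I))"
  have "\<delta>' > 0" using \<open>finite I\<close> \<delta>0 by (auto simp: \<delta>'_def)
  have \<delta>'_le: "\<delta>' \<le> \<delta> i" if "i \<in> I" for i using \<open>finite I\<close> that by (auto simp: \<delta>'_def)
  have "(\<Sum>(u, v)\<in>P. \<bar>F v - F u\<bar>) < \<epsilon>"
    if P: "nonoverlapping_intervals a b P" "(\<Sum>(u, v)\<in>P. v - u) < \<delta>'" for P
  proof -
    have "(\<Sum>(u, v)\<in>P. \<bar>F v - F u\<bar>) \<le> (\<Sum>(u, v)\<in>P. C * (\<Sum>i\<in>I. \<bar>f i v - f i u\<bar>))"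
      using P(1) lip by (intro sum_mono) (auto simp: nonoverlapping_intervals_def)
    also have "\<dots> = C * (\<Sum>i\<in>I. \<Sum>(u, v)\<in>P. \<bar>f i v - f i u\<bar>)"
      by (subst sum.swap) (simp add: split_def sum_distrib_left)
    also have "\<dots> \<le> C * (\<Sum>i\<in>I. \<eta>)"
    proof (intro mult_left_mono sum_mono \<open>C \<ge> 0\<close>)
      fix i assume i: "i \<in> I"
      have "(\<Sum>(u, v)\<in>P. v - u) < \<delta> i" using P(2) \<delta>'_le[OF i] by linarith
      with \<delta>[OF i] P(1) have "(\<Sum>(u, v)\<in>P. \<bar>f i v - f i u\<bar>) < \<eta>" by blast
      then show "(\<Sum>(u, v)\<in>P. \<bar>f i v - f i u\<bar>) \<le> \<eta>" by (rule less_imp_le)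
    qed
    also have "\<dots> < \<epsilon>" using \<eta> by simp
    finally show ?thesis .
  qed
  with \<open>\<delta>' > 0\<close> show "\<exists>\<delta>>0. \<forall>P. nonoverlapping_intervals a b P \<and>
        (\<Sum>(u, v)\<in>P. v - u) < \<delta>
        \<longrightarrow> (\<Sum>(u, v)\<in>P. \<bar>F v - F u\<bar>) < \<epsilon>"
    by blast
qed

text \<open>Away from zeros the sign of \<open>f\<close> is locally constant. At a zero with
  derivative 0 the difference quotients of |f| and f agree in absolute value, so both tend to 0, in
  accordance with sgn 0 = 0.\<close>

lemma has_real_derivative_abs_sgn:
  fixes f :: "real \<Rightarrow> real"
  assumes f: "(f has_real_derivative D) (at x)" and zero: "f x = 0 \<Longrightarrow> D = 0"
  shows "((\<lambda>t. \<bar>f t\<bar>) has_real_derivative sgn (f x) * D) (at x)"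
proof (cases "f x = 0")
  case True
  have "((\<lambda>y. (f y - f x) / (y - x)) \<longlongrightarrow> 0) (at x)"
    using f zero[OF True] by (simp add: has_field_derivative_iff)
  then have "((\<lambda>y. \<bar>(f y - f x) / (y - x)\<bar>) \<longlongrightarrow> 0) (at x)"
    by (simp only: tendsto_rabs_zero_iff)
  then have "((\<lambda>y. \<bar>(\<bar>f y\<bar> - \<bar>f x\<bar>) / (y - x)\<bar>) \<longlongrightarrow> 0) (at x)"
    by (simp add: True)
  then show ?thesis
    by (simp only: tendsto_rabs_zero_iff has_field_derivative_iff True sgn_zero mult_zero_left)
next
  case False
  have "isCont f x" using f by (rule DERIV_isCont)
  then have lim: "(f \<longlongrightarrow> f x) (nhds x)"
    by (simp add: continuous_at tendsto_at_iff_tendsto_nhds)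
  show ?thesis
  proof (cases "f x > 0")
    case True
    then have "\<forall>\<^sub>F y in nhds x. \<bar>f y\<bar> = f y"
      using order_tendstoD(1)[OF lim True] by (auto elim!: eventually_mono)
    with f True show ?thesis by (subst DERIV_cong_ev[OF refl _ refl]) simp_all
  next
    case neg: False
    with False have "f x < 0" by simp
    then have "\<forall>\<^sub>F y in nhds x. \<bar>f y\<bar> = - f y"
      using order_tendstoD(2)[OF lim, of 0] by (auto elim!: eventually_mono)
    with DERIV_minus[OF f] \<open>f x < 0\<close> show ?thesis by (subst DERIV_cong_ev[OF refl _ refl]) simp_all
  qed
qed

section \<open>Gronwall inequalities\<close>

lemma abs_ln_diff_le:
  fixes x y m :: real
  assumes "0 < m" "m \<le> x" "m \<le> y"
  shows "\<bar>ln x - ln y\<bar> \<le> \<bar>x - y\<bar> / m"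
proof -
  have *: "ln s - ln r \<le> \<bar>s - r\<bar> / m" if "m \<le> r" "m \<le> s" for r s :: real
  proof -
    have "ln s - ln r = ln (s / r)" using that \<open>0 < m\<close> by (simp add: ln_div)
    also have "\<dots> \<le> s / r - 1" using that \<open>0 < m\<close> by (intro ln_le_minus_one) simp
    also have "\<dots> = (s - r) / r" using that \<open>0 < m\<close> by (simp add: field_simps)
    also have "\<dots> \<le> \<bar>s - r\<bar> / r" using that \<open>0 < m\<close> by (intro divide_right_mono) auto
    also have "\<dots> \<le> \<bar>s - r\<bar> / m" using that \<open>0 < m\<close> by (intro divide_left_mono) auto
    finally show ?thesis .
  qed
  show ?thesis using *[of x y] *[of y x] assms by (simp add: abs_minus_commute abs_le_iff)
qed

text \<open>On a compact interval V has a positive minimum \<open>V c\<close>, and on [V c,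
  infinity) the logarithm is Lipschitz with constant 1 / V c; hence ln V is again absolutely
  continuous.\<close>

lemma has_integral_ln_derivative:
  assumes "a \<le> b" and ac: "abs_continuous_on_interval a b V" and neg: "negligible E"
    and pos: "\<And>x. x \<in> {a..b} \<Longrightarrow> V x > 0"
    and deriv: "\<And>x. x \<in> {a..b} - E \<Longrightarrow> (V has_real_derivative V' x) (at x)"
  shows "((\<lambda>x. V' x / V x) has_integral (ln (V b) - ln (V a))) {a..b}"
proof (rule abs_continuous_has_integral_derivative[OF \<open>a \<le> b\<close> _ neg])
  obtain c where c: "c \<in> {a..b}" "\<And>x. x \<in> {a..b} \<Longrightarrow> V c \<le> V x"
    using continuous_attains_inf[OF compact_Icc _ abs_continuous_imp_continuous_on[OF ac]] \<open>a \<le> b\<close>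
    by auto
  show "abs_continuous_on_interval a b (\<lambda>x. ln (V x))"
  proof (rule abs_continuous_Lipschitz_combination[where I = "{()}" and f = "\<lambda>_. V" and C = "1 / V c"])
    show "\<bar>ln (V v) - ln (V u)\<bar> \<le> 1 / V c * (\<Sum>i\<in>{()}. \<bar>V v - V u\<bar>)" if "a \<le> u" "u \<le> v" "v \<le> b" for u v
      using abs_ln_diff_le[of "V c" "V v" "V u"] c pos that by simp
  qed (use ac c pos in \<open>auto intro: less_imp_le\<close>)
  show "((\<lambda>x. ln (V x)) has_real_derivative V' x / V x) (at x)" if "x \<in> {a..b} - E" for x
    using deriv[OF that] pos[of x] that by (auto intro!: derivative_eq_intros)
qed

text \<open>Up to the last zero of V before T there is nothing to prove, and after it the logarithm of V
  can be integrated; approaching that zero from the right contradicts V T > 0.\<close>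

lemma gronwall_upper:
  assumes "0 \<le> T" and ac: "abs_continuous_on_interval 0 T V" and neg: "negligible E"
    and nonneg: "\<And>x. x \<in> {0..T} \<Longrightarrow> V x \<ge> 0"
    and g: "g integrable_on {0..T}"
    and deriv: "\<And>x. x \<in> {0..T} - E \<Longrightarrow> (V has_real_derivative V' x) (at x) \<and> V' x \<le> - g x * V x"
  shows "V T \<le> exp (- integral {0..T} g) * V 0"
proof (cases "V T = 0")
  case True
  then show ?thesis using nonneg[of 0] \<open>0 \<le> T\<close> by simp
next
  case False
  then have VT: "V T > 0" using nonneg[of T] \<open>0 \<le> T\<close> by simp
  have cont: "continuous_on {0..T} V" using ac by (rule abs_continuous_imp_continuous_on)
  have step: "V T \<le> exp (- integral {u..T} g) * V u"
    if u: "0 \<le> u" "u \<le> T" "\<And>x. x \<in> {u..T} \<Longrightarrow> V x \<noteq> 0" for u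
  proof -
    have pos: "V x > 0" if "x \<in> {u..T}" for x
      using u(3)[OF that] nonneg[of x] u(1,2) that by auto
    have "((\<lambda>x. V' x / V x) has_integral (ln (V T) - ln (V u))) {u..T}"
      by (rule has_integral_ln_derivative[OF u(2) abs_continuous_on_interval_subset[OF ac] neg])
        (use u pos deriv in auto)
    \<comment> \<open>Nothing is known about V' on \<open>E\<close>. Replacing the integrand there
      by - g leaves the integral unchanged and makes the comparison hold at every point.\<close>
    then have "((\<lambda>x. if x \<in> E then - g x else V' x / V x) has_integral (ln (V T) - ln (V u))) {u..T}"
      by (rule has_integral_spike[OF neg, rotated]) simp
    moreover have "((\<lambda>x. - g x) has_integral (- integral {u..T} g)) {u..T}"
      using integrable_subinterval_real[OF g] u by (intro has_integral_neg integrable_integral) auto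
    ultimately have "ln (V T) - ln (V u) \<le> - integral {u..T} g"
    proof (rule has_integral_le)
      show "(if x \<in> E then - g x else V' x / V x) \<le> - g x" if "x \<in> {u..T}" for x
        using deriv[of x] pos[OF that] that u by (auto simp: field_simps)
    qed
    then have "exp (ln (V T)) \<le> exp (- integral {u..T} g + ln (V u))" by simp
    moreover have "V T > 0" "V u > 0" using pos u by auto
    ultimately show ?thesis by (simp only: exp_add exp_ln)
  qed
  show ?thesis
  proof (cases "\<exists>x\<in>{0..T}. V x = 0")
    case False
    then show ?thesis using step[of 0] \<open>0 \<le> T\<close> by auto
  next
    case True
    define Z where "Z = {x\<in>{0..T}. V x = 0}"
    have "closed Z" unfolding Z_def by (rule continuous_closed_preimage_constant[OF cont]) simp
    moreover have "Z \<noteq> {}" "bdd_above Z" using True by (auto simp: Z_def)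
    ultimately have sZ: "Sup Z \<in> Z" by (intro closed_contains_Sup)
    define s where "s = Sup Z"
    have s: "0 \<le> s" "s \<le> T" "V s = 0" using sZ by (auto simp: Z_def s_def)
    with VT have "s < T" by (cases "s = T") auto
    have nz: "V x \<noteq> 0" if "s < x" "x \<le> T" for x
    proof
      assume "V x = 0"
      then have "x \<in> Z" using that s by (auto simp: Z_def)
      then have "x \<le> s" unfolding s_def using \<open>bdd_above Z\<close> by (rule cSup_upper)
      with that show False by simp
    qed
    \<comment> \<open>The integral depends continuously on its lower limit, so the bound of
      \<open>step\<close>, valid for u > s, passes to u = s, where its right-hand side is 0.\<close>
    have "continuous_on {s..T} (\<lambda>u. exp (- integral {u..T} g) * V u)"
      using s integrable_subinterval_real[OF g, of s T] continuous_on_subset[OF cont, of "{s..T}"]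
      by (intro continuous_intros indefinite_integral_continuous_1') auto
    then have "((\<lambda>u. exp (- integral {u..T} g) * V u) \<longlongrightarrow> exp (- integral {s..T} g) * V s) (at s within {s..T})"
      unfolding continuous_on_def by (rule bspec) (use s in auto)
    moreover have "\<forall>\<^sub>F u in at s within {s..T}. V T \<le> exp (- integral {u..T} g) * V u"
      unfolding eventually_at_filter
      by (intro always_eventually allI impI step) (use s nz in auto)
    moreover have "at s within {s..T} \<noteq> bot"
      using \<open>s < T\<close> by (simp add: at_within_Icc_at_right)
    ultimately have "V T \<le> exp (- integral {s..T} g) * V s" by (rule tendsto_lowerbound)
    with s VT show ?thesis by simp
  qed
qed

text \<open>Here the first zero s of V matters: the bound holds on every [0, u] with u < s, and
  letting u tend to s from the left gives V s a positive lower bound. So V cannot reach zero from a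
  positive value.\<close>

lemma gronwall_lower:
  assumes "0 \<le> T" and ac: "abs_continuous_on_interval 0 T V" and neg: "negligible E"
    and nonneg: "\<And>x. x \<in> {0..T} \<Longrightarrow> V x \<ge> 0"
    and g: "g integrable_on {0..T}"
    and deriv: "\<And>x. x \<in> {0..T} - E \<Longrightarrow> (V has_real_derivative V' x) (at x) \<and> V' x \<ge> - g x * V x"
  shows "V T \<ge> exp (- integral {0..T} g) * V 0"
proof (cases "V 0 = 0")
  case True
  then show ?thesis using nonneg[of T] \<open>0 \<le> T\<close> by simp
next
  case False
  then have V0: "V 0 > 0" using nonneg[of 0] \<open>0 \<le> T\<close> by simp
  have cont: "continuous_on {0..T} V" using ac by (rule abs_continuous_imp_continuous_on)
  have step: "V u \<ge> exp (- integral {0..u} g) * V 0"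
    if u: "0 \<le> u" "u \<le> T" "\<And>x. x \<in> {0..u} \<Longrightarrow> V x \<noteq> 0" for u
  proof -
    have pos: "V x > 0" if "x \<in> {0..u}" for x
      using u(3)[OF that] nonneg[of x] u(1,2) that by auto
    have "((\<lambda>x. V' x / V x) has_integral (ln (V u) - ln (V 0))) {0..u}"
      by (rule has_integral_ln_derivative[OF u(1) abs_continuous_on_interval_subset[OF ac] neg])
        (use u pos deriv in auto)
    then have *: "((\<lambda>x. if x \<in> E then - g x else V' x / V x) has_integral (ln (V u) - ln (V 0))) {0..u}"
      by (rule has_integral_spike[OF neg, rotated]) simp
    have "((\<lambda>x. - g x) has_integral (- integral {0..u} g)) {0..u}"
      using integrable_subinterval_real[OF g] u by (intro has_integral_neg integrable_integral) auto
    then have "- integral {0..u} g \<le> ln (V u) - ln (V 0)"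
      using *
    proof (rule has_integral_le)
      show "- g x \<le> (if x \<in> E then - g x else V' x / V x)" if "x \<in> {0..u}" for x
        using deriv[of x] pos[OF that] that u by (auto simp: field_simps)
    qed
    then have "exp (- integral {0..u} g + ln (V 0)) \<le> exp (ln (V u))" by simp
    moreover have "V 0 > 0" "V u > 0" using pos u by auto
    ultimately show ?thesis by (simp only: exp_add exp_ln)
  qed
  show ?thesis
  proof (cases "\<exists>x\<in>{0..T}. V x = 0")
    case False
    then show ?thesis using step[of T] \<open>0 \<le> T\<close> by auto
  next
    case True
    define Z where "Z = {x\<in>{0..T}. V x = 0}"
    have "closed Z" unfolding Z_def by (rule continuous_closed_preimage_constant[OF cont]) simp
    moreover have "Z \<noteq> {}" "bdd_below Z" using True by (auto simp: Z_def)
    ultimately have sZ: "Inf Z \<in> Z" by (intro closed_contains_Inf)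
    define s where "s = Inf Z"
    have s: "0 \<le> s" "s \<le> T" "V s = 0" using sZ by (auto simp: Z_def s_def)
    with V0 have "0 < s" by (cases "s = 0") auto
    have nz: "V x \<noteq> 0" if "0 \<le> x" "x < s" for x
    proof
      assume "V x = 0"
      then have "x \<in> Z" using that s by (auto simp: Z_def)
      then have "s \<le> x" unfolding s_def using \<open>bdd_below Z\<close> by (rule cInf_lower)
      with that show False by simp
    qed
    have "continuous_on {0..s} (\<lambda>u. V u - exp (- integral {0..u} g) * V 0)"
      using s integrable_subinterval_real[OF g, of 0 s] continuous_on_subset[OF cont, of "{0..s}"]
      by (intro continuous_intros indefinite_integral_continuous_1) auto
    then have "((\<lambda>u. V u - exp (- integral {0..u} g) * V 0) \<longlongrightarrow> V s - exp (- integral {0..s} g) * V 0)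
        (at s within {0..s})"
      unfolding continuous_on_def by (rule bspec) (use s in auto)
    moreover have "\<forall>\<^sub>F u in at s within {0..s}. 0 \<le> V u - exp (- integral {0..u} g) * V 0"
      unfolding eventually_at_filter diff_ge_0_iff_ge
      by (intro always_eventually allI impI step) (use s nz in auto)
    moreover have "at s within {0..s} \<noteq> bot"
      using \<open>0 < s\<close> by (simp add: at_within_Icc_at_left)
    ultimately have "0 \<le> V s - exp (- integral {0..s} g) * V 0" by (rule tendsto_lowerbound)
    moreover have "exp (- integral {0..s} g) * V 0 > 0" using V0 by simp
    ultimately show ?thesis using s by simp
  qed
qed

section \<open>Chains with absorption in zero\<close>

text \<open>Absolute integrability is carried along because it survives pointwise minima and maxima;
  conditional gauge integrability does not.\<close>

lemma absolutely_integrable_Min: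
  fixes f :: "'i \<Rightarrow> 'n::euclidean_space \<Rightarrow> real"
  assumes "finite I" "I \<noteq> {}" "\<And>i. i \<in> I \<Longrightarrow> f i absolutely_integrable_on X"
  shows "(\<lambda>x. Min ((\<lambda>i. f i x) ` I)) absolutely_integrable_on X"
  using assms by (induction rule: finite_ne_induct) (simp_all add: absolutely_integrable_min_1)

lemma absolutely_integrable_Max:
  fixes f :: "'i \<Rightarrow> 'n::euclidean_space \<Rightarrow> real"
  assumes "finite I" "I \<noteq> {}" "\<And>i. i \<in> I \<Longrightarrow> f i absolutely_integrable_on X"
  shows "(\<lambda>x. Max ((\<lambda>i. f i x) ` I)) absolutely_integrable_on X"
  using assms by (induction rule: finite_ne_induct) (simp_all add: absolutely_integrable_max_1)

locale absorbing_chain =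
  fixes S :: nat and q :: "nat \<Rightarrow> nat \<Rightarrow> real \<Rightarrow> real" and d :: "nat \<Rightarrow> real"
  assumes S_pos: "S \<ge> 1"
    and q_nonneg: "\<And>i j t. i \<in> {0..S} \<Longrightarrow> j \<in> {0..S} \<Longrightarrow> i \<noteq> j \<Longrightarrow> t \<ge> 0 \<Longrightarrow> q i j t \<ge> 0"
    and q_integrable: "\<And>i j. i \<in> {0..S} \<Longrightarrow> j \<in> {0..S} \<Longrightarrow> i \<noteq> j \<Longrightarrow> locally_integrable (q i j)"
    and absorbing: "\<And>j t. j \<in> {1..S} \<Longrightarrow> t \<ge> 0 \<Longrightarrow> q 0 j t = 0"
    and d_pos: "\<And>i. i \<in> {1..S} \<Longrightarrow> d i > 0"
begin

section \<open>Column sums of the transposed intensity matrix\<close>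

abbreviation A :: "real \<Rightarrow> nat \<Rightarrow> nat \<Rightarrow> real" where
  "A \<equiv> transposed_intensity S q"

lemma A_offdiag_nonneg: "i \<in> {0..S} \<Longrightarrow> j \<in> {0..S} \<Longrightarrow> i \<noteq> j \<Longrightarrow> t \<ge> 0 \<Longrightarrow> 0 \<le> A t i j"
  using q_nonneg by (simp add: transposed_intensity_def)

lemma A_column_sum: "j \<in> {0..S} \<Longrightarrow> (\<Sum>i\<in>{0..S}. A t i j) = 0"
  by (subst sum.remove[of _ j]) (auto simp: transposed_intensity_def)

lemma A_reduced_column_sum:
  assumes "j \<in> {1..S}" "t \<ge> 0"
  shows "(\<Sum>i\<in>{1..S}. A t i j) \<le> 0"
proof -
  have "(\<Sum>i\<in>{0..S}. A t i j) = A t 0 j + (\<Sum>i\<in>{1..S}. A t i j)"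
    by (simp add: sum.atLeast_Suc_atMost)
  moreover have "A t 0 j \<ge> 0" using assms by (intro A_offdiag_nonneg) auto
  ultimately show ?thesis using A_column_sum[of j t] assms by simp
qed

text \<open>Divided by \<open>d k\<close>, the left-hand side is the k-th column sum of D B D^{-1},
  and \<open>alpha\<close> is minus that sum.\<close>

lemma weighted_column_sum:
  assumes "k \<in> {1..S}"
  shows "(\<Sum>i\<in>{1..S}. d i * A t i k) = - d k * alpha S q d k t"
proof -
  have "(\<Sum>i\<in>{1..S}. d i * A t i k) = d k * A t k k + (\<Sum>i\<in>{1..S} - {k}. d i * A t i k)"
    using assms by (intro sum.remove) auto
  also have "(\<Sum>i\<in>{1..S} - {k}. d i * A t i k) = d k * (\<Sum>i\<in>{1..S} - {k}. d i / d k * A t i k)"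
    using d_pos[OF assms] by (simp add: sum_distrib_left)
  finally show ?thesis by (simp add: alpha_def algebra_simps)
qed

lemma alpha_integrable:
  assumes "k \<in> {1..S}" "T \<ge> 0"
  shows "alpha S q d k absolutely_integrable_on {0..T}"
proof -
  have "q i j absolutely_integrable_on {0..T}" if "i \<in> {0..S}" "j \<in> {0..S}" "i \<noteq> j" for i j
    using q_integrable[OF that] \<open>T \<ge> 0\<close> by (simp add: locally_integrable_def)
  then have "(\<lambda>t. (\<Sum>j\<in>{0..S} - {k}. q k j t) - (\<Sum>i\<in>{1..S} - {k}. d i / d k * q k i t))
      absolutely_integrable_on {0..T}"
    using assms(1) by (intro set_integral_diff absolutely_integrable_sum set_integrable_mult_right) auto
  moreover have "alpha S q d k = (\<lambda>t. (\<Sum>j\<in>{0..S} - {k}. q k j t) - (\<Sum>i\<in>{1..S} - {k}. d i / d k * q k i t))"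
    by (auto simp: alpha_def transposed_intensity_def intro!: ext sum.cong)
  ultimately show ?thesis by simp
qed

lemma beta_integrable:
  assumes "T \<ge> 0"
  shows "beta_min S q d integrable_on {0..T}" "beta_max S q d integrable_on {0..T}"
proof -
  have "beta_min S q d absolutely_integrable_on {0..T}" "beta_max S q d absolutely_integrable_on {0..T}"
    unfolding beta_min_def[abs_def] beta_max_def[abs_def]
    using S_pos alpha_integrable[OF _ assms]
    by (auto intro!: absolutely_integrable_Min absolutely_integrable_Max)
  then show "beta_min S q d integrable_on {0..T}" "beta_max S q d integrable_on {0..T}"
    using set_lebesgue_integral_eq_integral(1) by blast+
qed

text \<open>On the diagonal sgn (w_j) w_j = |w_j| exactly, so the sign of a_jj is irrelevant; off
  the diagonal sgn (w_i) w_j <= |w_j| is multiplied by a nonnegative rate. The weights stay general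
  to serve both c = d (the norm) and c = 1 (preservation of nonnegativity).\<close>

lemma sgn_weighted_le:
  assumes "t \<ge> 0" and c: "\<And>i. i \<in> {1..S} \<Longrightarrow> c i \<ge> 0"
  shows "(\<Sum>i\<in>{1..S}. c i * (sgn (w i) * (\<Sum>j\<in>{1..S}. A t i j * w j)))
     \<le> (\<Sum>j\<in>{1..S}. \<bar>w j\<bar> * (\<Sum>i\<in>{1..S}. c i * A t i j))"
proof -
  have "(\<Sum>i\<in>{1..S}. c i * (sgn (w i) * (\<Sum>j\<in>{1..S}. A t i j * w j)))
      = (\<Sum>j\<in>{1..S}. \<Sum>i\<in>{1..S}. c i * (A t i j * (sgn (w i) * w j)))"
    by (subst sum.swap) (simp add: sum_distrib_left mult_ac)
  also have "\<dots> \<le> (\<Sum>j\<in>{1..S}. \<Sum>i\<in>{1..S}. c i * (A t i j * \<bar>w j\<bar>))"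
  proof (intro sum_mono, rule mult_left_mono)
    fix j i assume ij: "j \<in> {1..S}" "i \<in> {1..S}"
    show "c i \<ge> 0" using ij by (intro c)
    show "A t i j * (sgn (w i) * w j) \<le> A t i j * \<bar>w j\<bar>"
    proof (cases "i = j")
      case True
      then show ?thesis by (simp add: abs_sgn mult.commute)
    next
      case False
      then have "0 \<le> A t i j" using ij \<open>t \<ge> 0\<close> by (intro A_offdiag_nonneg) auto
      moreover have "sgn (w i) * w j \<le> \<bar>w j\<bar>" by (auto simp: sgn_if)
      ultimately show ?thesis by (rule mult_left_mono[rotated])
    qed
  qed
  also have "\<dots> = (\<Sum>j\<in>{1..S}. \<bar>w j\<bar> * (\<Sum>i\<in>{1..S}. c i * A t i j))"
    by (simp add: sum_distrib_left mult_ac)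
  finally show ?thesis .
qed

text \<open>The last clause holds for solutions of the reduced system after enlarging E by the countably
  many points where some coordinate vanishes with nonzero derivative.\<close>

definition reduced_solution :: "real set \<Rightarrow> (real \<Rightarrow> nat \<Rightarrow> real) \<Rightarrow> bool" where
  "reduced_solution E w \<longleftrightarrow>
     negligible E \<and> (\<forall>i\<in>{1..S}. locally_abs_continuous (\<lambda>t. w t i)) \<and>
     (\<forall>t\<ge>0. t \<notin> E \<longrightarrow> (\<forall>i\<in>{1..S}.
        ((\<lambda>s. w s i) has_real_derivative (\<Sum>j\<in>{1..S}. A t i j * w t j)) (at t) \<and>
        (w t i = 0 \<longrightarrow> (\<Sum>j\<in>{1..S}. A t i j * w t j) = 0)))"

lemma kolmogorov_solution_diff:
  assumes "kolmogorov_solution S q p" "kolmogorov_solution S q p'"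
  obtains E where "reduced_solution E (\<lambda>t i. p t i - p' t i)"
proof -
  define w where "w t i = p t i - p' t i" for t i
  obtain N where N: "negligible N" "\<And>t i. t \<ge> 0 \<Longrightarrow> t \<notin> N \<Longrightarrow> i \<in> {0..S} \<Longrightarrow>
      ((\<lambda>s. p s i) has_real_derivative (\<Sum>j\<in>{0..S}. A t i j * p t j)) (at t)"
    using assms(1) unfolding kolmogorov_solution_def eventually_ae_filter_negligible by blast
  obtain N' where N': "negligible N'" "\<And>t i. t \<ge> 0 \<Longrightarrow> t \<notin> N' \<Longrightarrow> i \<in> {0..S} \<Longrightarrow>
      ((\<lambda>s. p' s i) has_real_derivative (\<Sum>j\<in>{0..S}. A t i j * p' t j)) (at t)"
    using assms(2) unfolding kolmogorov_solution_def eventually_ae_filter_negligible by blast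
  \<comment> \<open>The corners of |w_i|: zeros crossed with nonzero speed. Off \<open>Z i\<close>,
    a zero at which the derivative exists must have derivative 0.\<close>
  define Z where "Z i = {t. w t i = 0 \<and> (\<exists>D. ((\<lambda>s. w s i) has_real_derivative D) (at t) \<and> D \<noteq> 0)}" for i
  define E where "E = N \<union> N' \<union> (\<Union>i\<in>{1..S}. Z i)"
  have "countable (\<Union>i\<in>{1..S}. Z i)"
    unfolding Z_def by (intro countable_UN countable_transversal_zeros) auto
  then have "negligible (\<Union>i\<in>{1..S}. Z i)"
    by (simp only: negligible_iff_null_sets null_sets_completionI countable_imp_null_set_lborel)
  then have "negligible E"
    unfolding E_def using N(1) N'(1) by (intro negligible_Un)
  moreover have "locally_abs_continuous (\<lambda>t. w t i)" if i: "i \<in> {1..S}" for i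
    unfolding locally_abs_continuous_def
  proof (intro allI impI)
    fix T :: real assume "T \<ge> 0"
    show "abs_continuous_on_interval 0 T (\<lambda>t. w t i)"
    \<comment> \<open>The two truth values index the two functions whose difference is
      taken.\<close>
    proof (rule abs_continuous_Lipschitz_combination[where I = UNIV and C = 1
          and f = "\<lambda>b t. if b then p t i else p' t i"])
      show "abs_continuous_on_interval 0 T (\<lambda>t. if b then p t i else p' t i)" for b
        using assms i \<open>T \<ge> 0\<close> by (cases b) (simp_all add: kolmogorov_solution_def locally_abs_continuous_def)
    qed (auto simp: UNIV_bool w_def)
  qed
  moreover have "((\<lambda>s. w s i) has_real_derivative (\<Sum>j\<in>{1..S}. A t i j * w t j)) (at t) \<and>
        (w t i = 0 \<longrightarrow> (\<Sum>j\<in>{1..S}. A t i j * w t j) = 0)"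
    if t: "t \<ge> 0" "t \<notin> E" and i: "i \<in> {1..S}" for t i
  proof -
    have "((\<lambda>s. w s i) has_real_derivative
        (\<Sum>j\<in>{0..S}. A t i j * p t j) - (\<Sum>j\<in>{0..S}. A t i j * p' t j)) (at t)"
      unfolding w_def using t i N(2) N'(2) by (intro DERIV_diff) (auto simp: E_def)
    also have "(\<Sum>j\<in>{0..S}. A t i j * p t j) - (\<Sum>j\<in>{0..S}. A t i j * p' t j) = (\<Sum>j\<in>{0..S}. A t i j * w t j)"
      by (simp add: w_def algebra_simps sum_subtractf)
    also have "\<dots> = A t i 0 * w t 0 + (\<Sum>j\<in>{1..S}. A t i j * w t j)"
      by (simp add: sum.atLeast_Suc_atMost)
    \<comment> \<open>This entry is \<open>q 0 i t\<close>, the rate of leaving the absorbing state;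
      its vanishing removes coordinate 0 from the equation.\<close>
    also have "A t i 0 = 0"
      using i t absorbing[of i t] by (simp add: transposed_intensity_def)
    finally have D: "((\<lambda>s. w s i) has_real_derivative (\<Sum>j\<in>{1..S}. A t i j * w t j)) (at t)" by simp
    moreover have "t \<notin> Z i" using t i by (auto simp: E_def)
    ultimately show ?thesis unfolding Z_def by blast
  qed
  ultimately have "reduced_solution E w"
    unfolding reduced_solution_def by blast
  then show thesis using that unfolding w_def[abs_def] by blast
qed

section \<open>Weighted norms along the difference of two solutions\<close>

context
  fixes E w assumes w: "reduced_solution E w"
begin

text \<open>Two weight families cover both functionals in use: c = d, e = 0 is the weighted norm,
  and c = 1, e = -1 is the sum of |w_i| - w_i.\<close>

lemma abs_continuous_weighted_norm:
  assumes "T \<ge> 0"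
  shows "abs_continuous_on_interval 0 T (\<lambda>t. \<Sum>i\<in>{1..S}. c i * \<bar>w t i\<bar> + e i * w t i)"
proof (rule abs_continuous_Lipschitz_combination[where I = "{1..S}" and f = "\<lambda>i t. w t i"
      and C = "\<Sum>i\<in>{1..S}. \<bar>c i\<bar> + \<bar>e i\<bar>"])
  fix u v
  have "(\<Sum>i\<in>{1..S}. c i * \<bar>w v i\<bar> + e i * w v i) - (\<Sum>i\<in>{1..S}. c i * \<bar>w u i\<bar> + e i * w u i)
      = (\<Sum>i\<in>{1..S}. c i * (\<bar>w v i\<bar> - \<bar>w u i\<bar>) + e i * (w v i - w u i))"
    by (simp add: sum_subtractf[symmetric] algebra_simps)
  also have "\<bar>\<dots>\<bar> \<le> (\<Sum>i\<in>{1..S}. (\<bar>c i\<bar> + \<bar>e i\<bar>) * \<bar>w v i - w u i\<bar>)"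
  proof (rule order_trans[OF sum_abs], rule sum_mono)
    fix i
    have "\<bar>c i * (\<bar>w v i\<bar> - \<bar>w u i\<bar>) + e i * (w v i - w u i)\<bar>
        \<le> \<bar>c i\<bar> * \<bar>\<bar>w v i\<bar> - \<bar>w u i\<bar>\<bar> + \<bar>e i\<bar> * \<bar>w v i - w u i\<bar>"
      by (rule order_trans[OF abs_triangle_ineq]) (simp add: abs_mult)
    also have "\<bar>c i\<bar> * \<bar>\<bar>w v i\<bar> - \<bar>w u i\<bar>\<bar> \<le> \<bar>c i\<bar> * \<bar>w v i - w u i\<bar>"
      by (intro mult_left_mono abs_triangle_ineq3) simp
    finally show "\<bar>c i * (\<bar>w v i\<bar> - \<bar>w u i\<bar>) + e i * (w v i - w u i)\<bar> \<le> (\<bar>c i\<bar> + \<bar>e i\<bar>) * \<bar>w v i - w u i\<bar>"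
      by (simp add: distrib_right)
  qed
  also have "\<dots> \<le> (\<Sum>i\<in>{1..S}. (\<Sum>k\<in>{1..S}. \<bar>c k\<bar> + \<bar>e k\<bar>) * \<bar>w v i - w u i\<bar>)"
    by (intro sum_mono mult_right_mono member_le_sum) auto
  finally show "\<bar>(\<Sum>i\<in>{1..S}. c i * \<bar>w v i\<bar> + e i * w v i) - (\<Sum>i\<in>{1..S}. c i * \<bar>w u i\<bar> + e i * w u i)\<bar>
      \<le> (\<Sum>i\<in>{1..S}. \<bar>c i\<bar> + \<bar>e i\<bar>) * (\<Sum>i\<in>{1..S}. \<bar>w v i - w u i\<bar>)"
    by (simp add: sum_distrib_left)
qed (use w assms in \<open>auto simp: reduced_solution_def locally_abs_continuous_def intro!: sum_nonneg\<close>)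

lemma weighted_norm_derivative:
  assumes "t \<ge> 0" "t \<notin> E"
  shows "((\<lambda>t. \<Sum>i\<in>{1..S}. c i * \<bar>w t i\<bar> + e i * w t i) has_real_derivative
    (\<Sum>i\<in>{1..S}. c i * (sgn (w t i) * (\<Sum>j\<in>{1..S}. A t i j * w t j)) + e i * (\<Sum>j\<in>{1..S}. A t i j * w t j))) (at t)"
  using w assms unfolding reduced_solution_def
  by (intro DERIV_sum DERIV_add DERIV_cmult has_real_derivative_abs_sgn) auto

text \<open>\<open>U\<close> is twice the total negative part of w. The sign estimate bounds its
  derivative by the sum of (|w_j| - w_j) times the j-th column sum of B, which is nonpositive;
  Gronwall with rate 0 then keeps \<open>U\<close> at its initial value 0.\<close>

lemma reduced_solution_nonneg:
  assumes init: "\<And>i. i \<in> {1..S} \<Longrightarrow> w 0 i \<ge> 0" and "T \<ge> 0" "k \<in> {1..S}"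
  shows "w T k \<ge> 0"
proof -
  define U where "U t = (\<Sum>i\<in>{1..S}. 1 * \<bar>w t i\<bar> + (-1) * w t i)" for t
  define U' where "U' t = (\<Sum>i\<in>{1..S}. 1 * (sgn (w t i) * (\<Sum>j\<in>{1..S}. A t i j * w t j))
      + (-1) * (\<Sum>j\<in>{1..S}. A t i j * w t j))" for t
  have "U T \<le> exp (- integral {0..T} (\<lambda>_. 0)) * U 0"
  proof (rule gronwall_upper[OF \<open>T \<ge> 0\<close>, of U E "\<lambda>_. 0" U'])
    show "abs_continuous_on_interval 0 T U"
      unfolding U_def by (rule abs_continuous_weighted_norm[OF \<open>T \<ge> 0\<close>])
    show "negligible E" using w by (simp add: reduced_solution_def)
    show "U t \<ge> 0" for t unfolding U_def by (intro sum_nonneg) simp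
    show "(U has_real_derivative U' t) (at t) \<and> U' t \<le> - 0 * U t" if "t \<in> {0..T} - E" for t
    proof
      have t: "t \<ge> 0" "t \<notin> E" using that by auto
      show "(U has_real_derivative U' t) (at t)"
        unfolding U_def U'_def by (rule weighted_norm_derivative[OF t])
      have "U' t = (\<Sum>i\<in>{1..S}. 1 * (sgn (w t i) * (\<Sum>j\<in>{1..S}. A t i j * w t j)))
          - (\<Sum>j\<in>{1..S}. w t j * (\<Sum>i\<in>{1..S}. A t i j))"
      proof -
        have "(\<Sum>j\<in>{1..S}. w t j * (\<Sum>i\<in>{1..S}. A t i j)) = (\<Sum>i\<in>{1..S}. \<Sum>j\<in>{1..S}. A t i j * w t j)"
          unfolding sum_distrib_left by (subst sum.swap) (simp add: mult.commute)
        then show ?thesis by (simp add: U'_def sum_subtractf)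
      qed
      also have "\<dots> \<le> (\<Sum>j\<in>{1..S}. \<bar>w t j\<bar> * (\<Sum>i\<in>{1..S}. 1 * A t i j))
          - (\<Sum>j\<in>{1..S}. w t j * (\<Sum>i\<in>{1..S}. A t i j))"
        using t by (intro diff_right_mono sgn_weighted_le) auto
      also have "\<dots> = (\<Sum>j\<in>{1..S}. (\<bar>w t j\<bar> - w t j) * (\<Sum>i\<in>{1..S}. A t i j))"
        by (simp add: sum_subtractf left_diff_distrib)
      also have "\<dots> \<le> 0"
      proof (rule sum_nonpos)
        fix j assume "j \<in> {1..S}"
        then show "(\<bar>w t j\<bar> - w t j) * (\<Sum>i\<in>{1..S}. A t i j) \<le> 0"
          using t by (intro mult_nonneg_nonpos A_reduced_column_sum) auto
      qed
      finally show "U' t \<le> - 0 * U t" by simp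
    qed
  qed auto
  also have "U 0 = 0" using init by (simp add: U_def)
  finally have "U T \<le> 0" by simp
  moreover have "\<bar>w T k\<bar> - w T k \<le> U T"
    unfolding U_def using \<open>k \<in> {1..S}\<close> by (intro order_trans[OF _ member_le_sum[of k]]) auto
  ultimately show ?thesis by linarith
qed

text \<open>The summand \<open>0 * x i\<close> puts the norm into the two-weight form of
  \<open>abs_continuous_weighted_norm\<close> and \<open>weighted_norm_derivative\<close>.\<close>

lemma norm_1D_eq: "norm_1D S d x = (\<Sum>i\<in>{1..S}. d i * \<bar>x i\<bar> + 0 * x i)"
  using d_pos by (auto simp: norm_1D_def l1_norm_def abs_mult less_imp_le intro!: sum.cong)

lemma norm_1D_upper:
  assumes "T \<ge> 0"
  shows "norm_1D S d (w T) \<le> exp (- integral {0..T} (beta_min S q d)) * norm_1D S d (w 0)"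
proof (rule gronwall_upper[OF assms, of "\<lambda>t. norm_1D S d (w t)" E])
  show "abs_continuous_on_interval 0 T (\<lambda>t. norm_1D S d (w t))"
    unfolding norm_1D_eq by (rule abs_continuous_weighted_norm[OF assms])
  show "negligible E" using w by (simp add: reduced_solution_def)
  show "norm_1D S d (w t) \<ge> 0" for t by (simp add: norm_1D_def l1_norm_def sum_nonneg)
  show "beta_min S q d integrable_on {0..T}" using assms by (rule beta_integrable)
  fix t assume "t \<in> {0..T} - E"
  then have t: "t \<ge> 0" "t \<notin> E" by auto
  let ?V' = "\<Sum>i\<in>{1..S}. d i * (sgn (w t i) * (\<Sum>j\<in>{1..S}. A t i j * w t j)) + 0 * (\<Sum>j\<in>{1..S}. A t i j * w t j)"
  have "?V' \<le> (\<Sum>j\<in>{1..S}. \<bar>w t j\<bar> * (\<Sum>i\<in>{1..S}. d i * A t i j))"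
    using sgn_weighted_le[OF t(1), of d "w t"] d_pos by (simp add: less_imp_le)
  also have "\<dots> = (\<Sum>j\<in>{1..S}. d j * \<bar>w t j\<bar> * (- alpha S q d j t))"
    by (intro sum.cong refl, subst weighted_column_sum) auto
  also have "\<dots> \<le> (\<Sum>j\<in>{1..S}. d j * \<bar>w t j\<bar> * (- beta_min S q d t))"
    using d_pos by (intro sum_mono mult_left_mono) (auto simp: beta_min_def less_imp_le)
  also have "\<dots> = - beta_min S q d t * norm_1D S d (w t)"
    by (simp add: norm_1D_eq sum_distrib_left sum_negf mult_ac)
  finally show "((\<lambda>t. norm_1D S d (w t)) has_real_derivative ?V') (at t) \<and>
      ?V' \<le> - beta_min S q d t * norm_1D S d (w t)"
    unfolding norm_1D_eq using weighted_norm_derivative[OF t, of d "\<lambda>_. 0"] by blast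
qed

text \<open>For nonnegative w the sign estimate loses nothing: the derivative of the norm is exactly
  the sum of - alpha_j d_j w_j, and the only inequality left is alpha_j <= \<beta>_*.\<close>

lemma norm_1D_lower:
  assumes init: "\<And>i. i \<in> {1..S} \<Longrightarrow> w 0 i \<ge> 0" and "T \<ge> 0"
  shows "norm_1D S d (w T) \<ge> exp (- integral {0..T} (beta_max S q d)) * norm_1D S d (w 0)"
proof (rule gronwall_lower[OF \<open>T \<ge> 0\<close>, of "\<lambda>t. norm_1D S d (w t)" E])
  show "abs_continuous_on_interval 0 T (\<lambda>t. norm_1D S d (w t))"
    unfolding norm_1D_eq by (rule abs_continuous_weighted_norm[OF \<open>T \<ge> 0\<close>])
  show "negligible E" using w by (simp add: reduced_solution_def)
  show "norm_1D S d (w t) \<ge> 0" for t by (simp add: norm_1D_def l1_norm_def sum_nonneg)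
  show "beta_max S q d integrable_on {0..T}" using \<open>T \<ge> 0\<close> by (rule beta_integrable)
  fix t assume "t \<in> {0..T} - E"
  then have t: "t \<ge> 0" "t \<notin> E" by auto
  have nonneg: "w t j \<ge> 0" if "j \<in> {1..S}" for j
    using reduced_solution_nonneg[OF init t(1) that] by simp
  let ?V' = "\<Sum>i\<in>{1..S}. d i * (sgn (w t i) * (\<Sum>j\<in>{1..S}. A t i j * w t j)) + 0 * (\<Sum>j\<in>{1..S}. A t i j * w t j)"
  have "- beta_max S q d t * norm_1D S d (w t) = (\<Sum>j\<in>{1..S}. d j * \<bar>w t j\<bar> * (- beta_max S q d t))"
    by (simp add: norm_1D_eq sum_distrib_left sum_negf mult_ac)
  also have "\<dots> \<le> (\<Sum>j\<in>{1..S}. d j * \<bar>w t j\<bar> * (- alpha S q d j t))"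
    using d_pos by (intro sum_mono mult_left_mono) (auto simp: beta_max_def less_imp_le)
  also have "\<dots> = (\<Sum>j\<in>{1..S}. w t j * (\<Sum>i\<in>{1..S}. d i * A t i j))"
    using nonneg by (intro sum.cong refl, subst weighted_column_sum) auto
  also have "\<dots> = (\<Sum>i\<in>{1..S}. d i * (\<Sum>j\<in>{1..S}. A t i j * w t j))"
    unfolding sum_distrib_left by (subst sum.swap) (simp add: mult_ac)
  also have "\<dots> = ?V'"
  proof (intro sum.cong refl)
    fix i assume i: "i \<in> {1..S}"
    \<comment> \<open>Where w_i > 0 the sign is 1. Where w_i = 0 the left side is 0, and so is the
      right side by the last clause of \<open>reduced_solution\<close>.\<close>
    have "sgn (w t i) * (\<Sum>j\<in>{1..S}. A t i j * w t j) = (\<Sum>j\<in>{1..S}. A t i j * w t j)"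
      using w t i nonneg[OF i] unfolding reduced_solution_def by (cases "w t i = 0") auto
    then show "d i * (\<Sum>j\<in>{1..S}. A t i j * w t j) =
        d i * (sgn (w t i) * (\<Sum>j\<in>{1..S}. A t i j * w t j)) + 0 * (\<Sum>j\<in>{1..S}. A t i j * w t j)"
      by simp
  qed
  finally show "((\<lambda>t. norm_1D S d (w t)) has_real_derivative ?V') (at t) \<and>
      ?V' \<ge> - beta_max S q d t * norm_1D S d (w t)"
    unfolding norm_1D_eq using weighted_norm_derivative[OF t, of d "\<lambda>_. 0"] by blast
qed

end

section \<open>Conservation of mass and weak ergodicity\<close>

lemma kolmogorov_solution_mass:
  assumes p: "kolmogorov_solution S q p" and "T \<ge> 0"
  shows "(\<Sum>i\<in>{0..S}. p T i) = (\<Sum>i\<in>{0..S}. p 0 i)"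
proof -
  obtain N where N: "negligible N" "\<And>t i. t \<ge> 0 \<Longrightarrow> t \<notin> N \<Longrightarrow> i \<in> {0..S} \<Longrightarrow>
      ((\<lambda>s. p s i) has_real_derivative (\<Sum>j\<in>{0..S}. A t i j * p t j)) (at t)"
    using p unfolding kolmogorov_solution_def eventually_ae_filter_negligible by blast
  \<comment> \<open>The vanishing column sums of A give the mass derivative 0 off \<open>N\<close>;
    absolute continuity turns this into constancy.\<close>
  have "((\<lambda>_. 0) has_integral (\<Sum>i\<in>{0..S}. p T i) - (\<Sum>i\<in>{0..S}. p 0 i)) {0..T}"
  proof (rule abs_continuous_has_integral_derivative[OF \<open>T \<ge> 0\<close> _ N(1)])
    show "abs_continuous_on_interval 0 T (\<lambda>t. \<Sum>i\<in>{0..S}. p t i)"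
    proof (rule abs_continuous_Lipschitz_combination[where I = "{0..S}" and C = 1 and f = "\<lambda>i t. p t i"])
      show "\<bar>(\<Sum>i\<in>{0..S}. p v i) - (\<Sum>i\<in>{0..S}. p u i)\<bar> \<le> 1 * (\<Sum>i\<in>{0..S}. \<bar>p v i - p u i\<bar>)" for u v
        unfolding sum_subtractf[symmetric] by simp
    qed (use p \<open>T \<ge> 0\<close> in \<open>auto simp: kolmogorov_solution_def locally_abs_continuous_def\<close>)
  next
    fix t assume t: "t \<in> {0..T} - N"
    then have "((\<lambda>t. \<Sum>i\<in>{0..S}. p t i) has_real_derivative (\<Sum>i\<in>{0..S}. \<Sum>j\<in>{0..S}. A t i j * p t j)) (at t)"
      using N(2) by (intro DERIV_sum) auto
    also have "(\<Sum>i\<in>{0..S}. \<Sum>j\<in>{0..S}. A t i j * p t j) = (\<Sum>j\<in>{0..S}. (\<Sum>i\<in>{0..S}. A t i j) * p t j)"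
      by (subst sum.swap) (simp add: sum_distrib_right)
    also have "\<dots> = 0" using A_column_sum by simp
    finally show "((\<lambda>t. \<Sum>i\<in>{0..S}. p t i) has_real_derivative 0) (at t)" .
  qed
  then show ?thesis by (metis eq_iff_diff_eq_0 has_integral_0_eq)
qed

text \<open>Zero total mass makes |x_0| at most the sum of the other |x_i|, which costs a factor 2;
  passing to the weighted norm costs 1 / m with m the smallest weight.\<close>

lemma l1_norm_le_norm_1D:
  obtains C where "C \<ge> 0" "\<And>x. (\<Sum>i\<in>{0..S}. x i) = 0 \<Longrightarrow> l1_norm {0..S} x \<le> C * norm_1D S d x"
proof
  define m where "m = Min (d ` {1..S})"
  have m: "m > 0" "\<And>i. i \<in> {1..S} \<Longrightarrow> m \<le> d i"
    using S_pos d_pos by (auto simp: m_def)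
  show "2 / m \<ge> 0" using m by simp
  fix x :: "nat \<Rightarrow> real" assume sum0: "(\<Sum>i\<in>{0..S}. x i) = 0"
  have "x 0 = - (\<Sum>i\<in>{1..S}. x i)" using sum0 by (simp add: sum.atLeast_Suc_atMost)
  then have "\<bar>x 0\<bar> \<le> (\<Sum>i\<in>{1..S}. \<bar>x i\<bar>)" by simp
  then have "l1_norm {0..S} x \<le> 2 * (\<Sum>i\<in>{1..S}. \<bar>x i\<bar>)"
    by (simp add: l1_norm_def sum.atLeast_Suc_atMost)
  then have "m * l1_norm {0..S} x \<le> m * (2 * (\<Sum>i\<in>{1..S}. \<bar>x i\<bar>))"
    using m(1) by (intro mult_left_mono) auto
  moreover have "m * (\<Sum>i\<in>{1..S}. \<bar>x i\<bar>) \<le> norm_1D S d x"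
    unfolding norm_1D_def l1_norm_def sum_distrib_left
    using m d_pos by (intro sum_mono) (auto simp: abs_mult less_imp_le intro!: mult_right_mono)
  ultimately have "m * l1_norm {0..S} x \<le> 2 * norm_1D S d x" by linarith
  then show "l1_norm {0..S} x \<le> 2 / m * norm_1D S d x"
    using m(1) by (simp add: field_simps)
qed

lemma weakly_ergodic_if_beta_min_diverges:
  assumes div: "filterlim (\<lambda>T. integral {0..T} (beta_min S q d)) at_top at_top"
  shows "weakly_ergodic S q"
  unfolding weakly_ergodic_def
proof (intro allI impI)
  fix p p' assume "state_probabilities S q p \<and> state_probabilities S q p'"
  then have sol: "kolmogorov_solution S q p" "kolmogorov_solution S q p'"
    and init: "(\<Sum>i\<in>{0..S}. p 0 i) = 1" "(\<Sum>i\<in>{0..S}. p' 0 i) = 1"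
    by (auto simp: state_probabilities_def prob_vector_def)
  define w where "w t i = p t i - p' t i" for t i
  obtain E where E: "reduced_solution E w"
    using kolmogorov_solution_diff[OF sol] unfolding w_def[abs_def] by blast
  obtain C where C: "C \<ge> 0" "\<And>x. (\<Sum>i\<in>{0..S}. x i) = 0 \<Longrightarrow> l1_norm {0..S} x \<le> C * norm_1D S d x"
    using l1_norm_le_norm_1D by blast
  have bound: "l1_norm {0..S} (w t) \<le> C * (exp (- integral {0..t} (beta_min S q d)) * norm_1D S d (w 0))"
    if "t \<ge> 0" for t
  proof -
    \<comment> \<open>Both masses start at 1 and are conserved, so the reduced norm controls
      coordinate 0 at every time t >= 0.\<close>
    have "(\<Sum>i\<in>{0..S}. w t i) = 0"
      using kolmogorov_solution_mass[OF sol(1) that] kolmogorov_solution_mass[OF sol(2) that] init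
      by (simp add: w_def sum_subtractf)
    then show ?thesis
      using C(2) mult_left_mono[OF norm_1D_upper[OF E that] C(1)] by (meson order_trans)
  qed
  have "((\<lambda>t. exp (- integral {0..t} (beta_min S q d))) \<longlongrightarrow> 0) at_top"
    using div by (intro filterlim_compose[OF exp_at_bot] filterlim_uminus_at_top[THEN iffD1])
  then have lim: "((\<lambda>t. C * (exp (- integral {0..t} (beta_min S q d)) * norm_1D S d (w 0))) \<longlongrightarrow> 0) at_top"
    by (intro tendsto_mult_right_zero tendsto_mult_left_zero)
  have "((\<lambda>t. l1_norm {0..S} (w t)) \<longlongrightarrow> 0) at_top"
  proof (rule tendsto_sandwich[OF _ _ tendsto_const lim])
    show "\<forall>\<^sub>F t in at_top. 0 \<le> l1_norm {0..S} (w t)"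
      by (simp add: l1_norm_def sum_nonneg)
    show "\<forall>\<^sub>F t in at_top. l1_norm {0..S} (w t)
        \<le> C * (exp (- integral {0..t} (beta_min S q d)) * norm_1D S d (w 0))"
      using eventually_ge_at_top[of 0] by (rule eventually_mono) (rule bound)
  qed
  then show "((\<lambda>t. l1_norm {0..S} (\<lambda>i. p t i - p' t i)) \<longlongrightarrow> 0) at_top"
    unfolding w_def[abs_def] .
qed

end

theorem theorem4:
  fixes S :: nat
    and q :: "nat \<Rightarrow> nat \<Rightarrow> real \<Rightarrow> real"
    and d :: "nat \<Rightarrow> real"
  assumes "S \<ge> 1"
    and "\<And>i j t. i \<in> {0..S} \<Longrightarrow> j \<in> {0..S} \<Longrightarrow> i \<noteq> j \<Longrightarrow> t \<ge> 0 \<Longrightarrow> q i j t \<ge> 0"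
    and "\<And>i j. i \<in> {0..S} \<Longrightarrow> j \<in> {0..S} \<Longrightarrow> i \<noteq> j \<Longrightarrow> locally_integrable (q i j)"
    and "\<And>j t. j \<in> {1..S} \<Longrightarrow> t \<ge> 0 \<Longrightarrow> q 0 j t = 0"
    and "\<And>i. i \<in> {1..S} \<Longrightarrow> d i > 0"
    and "filterlim (\<lambda>T. integral {0..T} (beta_min S q d)) at_top at_top"
  shows "weakly_ergodic S q \<and>
    (\<forall>p p'. state_probabilities S q p \<and> state_probabilities S q p' \<longrightarrow>
       (\<forall>t\<ge>0. norm_1D S d (\<lambda>i. p t i - p' t i)
          \<le> exp (- integral {0..t} (beta_min S q d)) * norm_1D S d (\<lambda>i. p 0 i - p' 0 i)) \<and>
       ((\<forall>i\<in>{1..S}. p 0 i - p' 0 i \<ge> 0) \<longrightarrow>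
          (\<forall>t\<ge>0. norm_1D S d (\<lambda>i. p t i - p' t i)
             \<ge> exp (- integral {0..t} (beta_max S q d)) * norm_1D S d (\<lambda>i. p 0 i - p' 0 i))))"
proof -
  interpret absorbing_chain S q d
    using assms(1-5) by unfold_locales
  show ?thesis
  proof (intro conjI allI)
    show "weakly_ergodic S q" using assms(6) by (rule weakly_ergodic_if_beta_min_diverges)
    fix p p'
    show "state_probabilities S q p \<and> state_probabilities S q p' \<longrightarrow>
       (\<forall>t\<ge>0. norm_1D S d (\<lambda>i. p t i - p' t i)
          \<le> exp (- integral {0..t} (beta_min S q d)) * norm_1D S d (\<lambda>i. p 0 i - p' 0 i)) \<and>
       ((\<forall>i\<in>{1..S}. p 0 i - p' 0 i \<ge> 0) \<longrightarrow>
          (\<forall>t\<ge>0. norm_1D S d (\<lambda>i. p t i - p' t i)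
             \<ge> exp (- integral {0..t} (beta_max S q d)) * norm_1D S d (\<lambda>i. p 0 i - p' 0 i)))"
    proof
      assume "state_probabilities S q p \<and> state_probabilities S q p'"
      then obtain E where E: "reduced_solution E (\<lambda>t i. p t i - p' t i)"
        using kolmogorov_solution_diff unfolding state_probabilities_def by blast
      show "(\<forall>t\<ge>0. norm_1D S d (\<lambda>i. p t i - p' t i)
          \<le> exp (- integral {0..t} (beta_min S q d)) * norm_1D S d (\<lambda>i. p 0 i - p' 0 i)) \<and>
       ((\<forall>i\<in>{1..S}. p 0 i - p' 0 i \<ge> 0) \<longrightarrow>
          (\<forall>t\<ge>0. norm_1D S d (\<lambda>i. p t i - p' t i)
             \<ge> exp (- integral {0..t} (beta_max S q d)) * norm_1D S d (\<lambda>i. p 0 i - p' 0 i)))"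
        using norm_1D_upper[OF E] norm_1D_lower[OF E] by blast
    qed
  qed
qed

end
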